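(* Let $\pi_{\rm joint}(\mathrm{d}\mathbf{x},\mathrm{d}\mathbf{y})=\pi_{\rm cond}(\mathrm{d}\mathbf{x}\mid\mathbf{y})\,\pi_{\rm marg}(\mathrm{d}\mathbf{y})$ be a probability distribution on $\mathbb{R}^{n_x}\times\mathbb{R}^{n_y}$. Let $\mu^t(\mathrm{d}\mathbf{y})$ denote the distribution of the $t$-th iterate of a Metropolis--Hastings Markov chain on $\mathbb{R}^{n_y}$ targeting $\pi_{\rm marg}$, with transition kernel $k_{\rm marg}$ and initial distribution $\mu^0(\mathrm{d}\mathbf{y})$. Let $\pi_{\tt M}^t(\mathrm{d}\mathbf{x},\mathrm{d}\mathbf{y})$ denote the distribution of the $t$-th iterate of the corresponding MarCo chain on $\mathbb{R}^{n_x}\times\mathbb{R}^{n_y}$, with transition kernel $k_{\tt M}((\mathbf{x},\mathbf{y}),(\mathrm{d}\hat{\mathbf{x}},\mathrm{d}\hat{\mathbf{y}}))=\pi_{\rm cond}(\mathrm{d}\hat{\mathbf{x}}\mid\hat{\mathbf{y}})\,k_{\rm marg}(\mathbf{y},\mathrm{d}\hat{\mathbf{y}})$ and initial distribution $\pi_{\tt M}^0(\mathrm{d}\mathbf{x},\mathrm{d}\mathbf{y})=\pi_{\rm cond}(\mathrm{d}\mathbf{x}\mid\mathbf{y})\,\mu^0(\mathrm{d}\mathbf{y})$. Then the following hold. (a) If $\mu^t\to\pi_{\rm marg}$ in total variation as $t\to\infty$, then $\pi_{\tt M}^t\to\pi_{\rm joint}$ in total variation as $t\to\infty$. (b) The mixing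 times of the marginal chain and the MarCo chain coincide: for every $\varepsilon>0$, $t_{\rm mix}(\varepsilon;\pi_{\tt M}^0)=t_{\rm mix}(\varepsilon;\mu^0)$, where the left-hand side is the mixing time of the MarCo chain to $\pi_{\rm joint}$ and the right-hand side is the mixing time of the marginal chain to $\pi_{\rm marg}$.
   Context: All target distributions are absolutely continuous with respect to Lebesgue measure, and the same symbol is used for a distribution and its density. $\pi_{\rm marg}(\mathbf{y})=\int_{\mathbb{R}^{n_x}}\pi_{\rm joint}(\mathbf{x},\mathbf{y})\,\mathrm{d}\mathbf{x}$ is the $\mathbf{y}$-marginal and $\pi_{\rm cond}(\mathrm{d}\mathbf{x}\mid\mathbf{y})$ is the conditional distribution of $\mathbf{x}$ given $\mathbf{y}$ (a Markov kernel from $\mathbb{R}^{n_y}$ to $\mathbb{R}^{n_x}$). Marginal Metropolis--Hastings kernel: given a proposal density $q_{\rm marg}(\hat{\mathbf{y}}\mid\mathbf{y})$ on $\mathbb{R}^{n_y}$, $$k_{\rm marg}(\mathbf{y},\mathrm{d}\hat{\mathbf{y}})=q_{\rm marg}(\hat{\mathbf{y}}\mid\mathbf{y})\,\alpha_{\rm marg}(\mathbf{y},\hat{\mathbf{y}})\,\mathrm{d}\hat{\mathbf{y}}+r_{\rm marg}(\mathbf{y})\,\delta_{\mathbf{y}}(\mathrm{d}\hat{\mathbf{y}}),$$ $$\alpha_{\rm marg}(\mathbf{y},\hat{\mathbf{y}})=\min\Big\{1,\frac{\pi_{\rm marg}(\hat{\mathbf{y}})\,q_{\rm marg}(\mathbf{y}\mid\hat{\mathbf{y}})}{\pi_{\rm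 marg}(\mathbf{y})\,q_{\rm marg}(\hat{\mathbf{y}}\mid\mathbf{y})}\Big\},\qquad r_{\rm marg}(\mathbf{y})=1-\int_{\mathbb{R}^{n_y}}q_{\rm marg}(\tilde{\mathbf{y}}\mid\mathbf{y})\,\alpha_{\rm marg}(\mathbf{y},\tilde{\mathbf{y}})\,\mathrm{d}\tilde{\mathbf{y}}$$ (with the usual convention $\alpha_{\rm marg}=1$ when the denominator vanishes). Total variation: $\|\pi'-\pi\|_{\rm TV}=\sup_{A}|\pi'(A)-\pi(A)|$ over Borel sets $A$. For a Markov chain with initial distribution $\pi^0$, law $\pi^t$ at time $t$, and stationary distribution $\pi$, the mixing time is $t_{\rm mix}(\varepsilon;\pi^0)=\min\{t\ge 0:\|\pi^t-\pi\|_{\rm TV}\le\varepsilon\}$ (equal to $+\infty$ if there is no such $t$). *)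

theory Defs
  imports "HOL-Probability.Probability" "HOL-Library.Extended_Nat"
begin

text \<open>Densities are real-valued functions with respect to \<open>lborel\<close>. A conditional density
  \<open>q(y' | y)\<close> is written \<open>q y' y\<close>.\<close>

text \<open>Where \<open>x \<mapsto> p (x, y)\<close> fails to be integrable (a null set of \<open>y\<close> for a probability
  density \<open>p\<close>) the Bochner integral is \<open>0\<close>; this only selects a version of the marginal density.\<close>

definition marg_density ::
    "('a::euclidean_space \<times> 'b::euclidean_space \<Rightarrow> real) \<Rightarrow> 'b \<Rightarrow> real" where
  "marg_density p y = (LINT x|lborel. p (x, y))"

definition mh_accept ::
    "('b::euclidean_space \<Rightarrow> real) \<Rightarrow> ('b \<Rightarrow> 'b \<Rightarrow> real) \<Rightarrow> 'b \<Rightarrow> 'b \<Rightarrow> real" where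
  "mh_accept f q y y' =
     (if f y * q y' y = 0 then 1 else min 1 ((f y' * q y y') / (f y * q y' y)))"

definition mh_reject ::
    "('b::euclidean_space \<Rightarrow> real) \<Rightarrow> ('b \<Rightarrow> 'b \<Rightarrow> real) \<Rightarrow> 'b \<Rightarrow> real" where
  "mh_reject f q y = 1 - (LINT z|lborel. q z y * mh_accept f q y z)"

text \<open>The Metropolis--Hastings kernel with target density \<open>f\<close> and proposal density \<open>q\<close>, given by
  its values on Borel sets; \<open>emeasure_mh_kernel\<close> below confirms that these form a measure.\<close>

definition mh_kernel ::
    "('b::euclidean_space \<Rightarrow> real) \<Rightarrow> ('b \<Rightarrow> 'b \<Rightarrow> real) \<Rightarrow> 'b \<Rightarrow> 'b measure" where
  "mh_kernel f q y = measure_of UNIV (sets borel)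
     (\<lambda>A. (\<integral>\<^sup>+y'\<in>A. ennreal (q y' y * mh_accept f q y y') \<partial>lborel)
           + ennreal (mh_reject f q y) * emeasure (return borel y) A)"

text \<open>The measure \<open>c(dx | y) \<nu>(dy)\<close> on pairs \<open>(x, y)\<close>.\<close>

definition kernel_joint ::
    "('b::euclidean_space \<Rightarrow> 'a::euclidean_space measure) \<Rightarrow> 'b measure \<Rightarrow> ('a \<times> 'b) measure" where
  "kernel_joint c \<nu> = \<nu> \<bind> (\<lambda>y. distr (c y) borel (\<lambda>x. (x, y)))"

definition marco_kernel ::
    "('b::euclidean_space \<Rightarrow> 'a::euclidean_space measure) \<Rightarrow> ('b \<Rightarrow> 'b measure)
      \<Rightarrow> 'a \<times> 'b \<Rightarrow> ('a \<times> 'b) measure" where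
  "marco_kernel c k = (\<lambda>(x, y). kernel_joint c (k y))"

primrec chain_law :: "('s \<Rightarrow> 's measure) \<Rightarrow> 's measure \<Rightarrow> nat \<Rightarrow> 's measure" where
  "chain_law k \<mu> 0 = \<mu>"
| "chain_law k \<mu> (Suc t) = chain_law k \<mu> t \<bind> k"

definition tv_dist :: "'s::topological_space measure \<Rightarrow> 's measure \<Rightarrow> real" where
  "tv_dist \<mu> \<nu> = (SUP A\<in>sets borel. \<bar>measure \<mu> A - measure \<nu> A\<bar>)"

text \<open>An infimum in \<open>enat\<close>: a minimum if some \<open>t\<close> qualifies, and \<open>\<infinity>\<close> otherwise.\<close>

definition mixing_time ::
    "('s::topological_space \<Rightarrow> 's measure) \<Rightarrow> 's measure \<Rightarrow> real \<Rightarrow> 's measure \<Rightarrow> enat" where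
  "mixing_time k \<pi> \<epsilon> \<mu> = Inf {enat t | t. tv_dist (chain_law k \<mu> t) \<pi> \<le> \<epsilon>}"

lemma sets_mh_kernel [simp]: "sets (mh_kernel f q y) = sets borel"
proof -
  have "sigma_sets UNIV (sets (borel :: 'a measure)) = sets borel"
    using sets.sigma_sets_eq[of "borel :: 'a measure"] by simp
  then show ?thesis
    by (simp add: mh_kernel_def)
qed

lemma emeasure_mh_kernel:
  assumes [measurable]: "f \<in> borel_measurable borel" "case_prod q \<in> borel_measurable borel"
    and A: "A \<in> sets borel"
  shows "emeasure (mh_kernel f q y) A =
    (\<integral>\<^sup>+y'\<in>A. ennreal (q y' y * mh_accept f q y y') \<partial>lborel)
      + ennreal (mh_reject f q y) * indicator A y"
proof -
  define g where "g = (\<lambda>y'. ennreal (q y' y * mh_accept f q y y'))"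
  have [measurable]: "(\<lambda>z. q z y) \<in> borel_measurable borel" "(\<lambda>z. q y z) \<in> borel_measurable borel"
    using measurable_compose[OF borel_measurable_Pair[OF measurable_ident_sets[OF refl] borel_measurable_const] assms(2)]
      measurable_compose[OF borel_measurable_Pair[OF borel_measurable_const measurable_ident_sets[OF refl]] assms(2)]
    by simp_all
  have g [measurable]: "g \<in> borel_measurable borel"
    unfolding g_def mh_accept_def by measurable
  let ?D = "density lborel g" and ?R = "return borel y"
  let ?m = "\<lambda>A. (\<integral>\<^sup>+y'\<in>A. g y' \<partial>lborel) + ennreal (mh_reject f q y) * emeasure ?R A"
  have D: "emeasure ?D B = (\<integral>\<^sup>+y'\<in>B. g y' \<partial>lborel)" if "B \<in> sets borel" for B
    using that by (subst emeasure_density) auto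
  have "emeasure (mh_kernel f q y) A = ?m A"
  proof (rule emeasure_measure_of)
    show "mh_kernel f q y = measure_of UNIV (sets borel) ?m"
      by (simp add: mh_kernel_def g_def)
    show "sets borel \<subseteq> Pow UNIV" by simp
    show "A \<in> sets (mh_kernel f q y)" using A by simp
    show "positive (sets (mh_kernel f q y)) ?m"
      by (simp add: positive_def)
    show "countably_additive (sets (mh_kernel f q y)) ?m"
    proof (rule countably_additiveI)
      fix F :: "nat \<Rightarrow> 'a set"
      assume F: "range F \<subseteq> sets (mh_kernel f q y)" "disjoint_family F"
      then have F': "F i \<in> sets borel" for i by auto
      have 1: "(\<Sum>i. emeasure ?D (F i)) = emeasure ?D (\<Union>i. F i)"
        using F by (intro suminf_emeasure) auto
      have 2: "(\<Sum>i. emeasure ?R (F i)) = emeasure ?R (\<Union>i. F i)"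
        using F by (intro suminf_emeasure) auto
      have U: "(\<Union>i. F i) \<in> sets borel" using F' by auto
      have "(\<Sum>i. ?m (F i)) = (\<Sum>i. \<integral>\<^sup>+y'\<in>F i. g y' \<partial>lborel)
              + (\<Sum>i. ennreal (mh_reject f q y) * emeasure ?R (F i))"
        by (intro suminf_add[symmetric] summableI)
      also have "\<dots> = ?m (\<Union>i. F i)"
        using 1 2 D[OF F'] D[OF U] by (simp del: emeasure_return add: ennreal_suminf_cmult)
      finally show "(\<Sum>i. ?m (F i)) = ?m (\<Union>i. F i)" .
    qed
  qed
  then show ?thesis
    using A by (simp add: g_def)
qed

end

theory Submission
  imports Defs
begin

text \<open>Write \<open>J \<nu> = kernel_joint c \<nu>\<close> for the law of \<open>(x, y)\<close> when \<open>y\<close> has law \<open>\<nu>\<close> and \<open>x\<close> is then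
  drawn from \<open>c y\<close>. Two observations give the theorem.

  The MarCo kernel looks only at the \<open>y\<close>-component of its argument, and it ends by drawing a fresh
  \<open>x\<close> from \<open>c\<close>. A step from \<open>J \<nu>\<close> therefore forgets \<open>x\<close>, moves \<open>y\<close> by the marginal kernel and
  lifts again, which leads to \<open>J (\<nu> \<bind> k)\<close>. Inductively, the MarCo law at time \<open>t\<close> is the lift of
  the marginal law at time \<open>t\<close> (\<open>chain_law_marco_kernel\<close>), just as the joint target is the lift
  of the marginal target.

  The map \<open>J\<close> is an isometry for total variation (\<open>tv_dist_kernel_joint\<close>). It does not increase
  the distance, because no Markov kernel does (\<open>tv_dist_bind_le\<close>). It does not decrease it,
  because \<open>\<nu>\<close> is recovered from \<open>J \<nu>\<close> on the cylinders \<open>UNIV \<times> B\<close>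
  (\<open>emeasure_kernel_joint_cylinder\<close>).

  Hence the distance to the target at time \<open>t\<close> is the same number for both chains, so convergence
  and mixing times agree. What remains is to check that the objects are genuine Markov kernels and
  probability measures; for the Metropolis--Hastings kernel this is \<open>mh_kernel_measurable\<close>.\<close>

section \<open>The Metropolis--Hastings kernel is a Markov kernel\<close>

lemma marg_density_nonneg:
  assumes "\<And>z. 0 \<le> p z"
  shows "0 \<le> marg_density p y"
  unfolding marg_density_def by (rule Bochner_Integration.integral_nonneg) (rule assms)

lemma borel_measurable_marg_density:
  fixes p :: "'a::euclidean_space \<times> 'b::euclidean_space \<Rightarrow> real"
  assumes [measurable]: "p \<in> borel_measurable borel"
  shows "marg_density p \<in> borel_measurable borel"
proof -
  have [measurable]: "p \<in> borel_measurable (borel \<Otimes>\<^sub>M borel)"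
    unfolding borel_prod by fact
  show ?thesis
    unfolding marg_density_def[abs_def] by measurable
qed

lemma mh_accept_nonneg:
  assumes "\<And>y. 0 \<le> f y" "\<And>y' y. 0 \<le> q y' y"
  shows "0 \<le> mh_accept f q y y'"
  using assms by (auto simp: mh_accept_def)

lemma mh_accept_le_1: "mh_accept f q y y' \<le> 1"
  by (simp add: mh_accept_def)

text \<open>The acceptance probability lies in \<open>[0, 1]\<close>, so the accepted mass is at most the total mass \<open>1\<close>
  of the proposal, and the rejection probability is exactly what is missing from \<open>1\<close>.
  Measurability in the starting point comes from that of parameter-dependent integrals.\<close>

lemma mh_kernel_measurable:
  fixes f :: "'b::euclidean_space \<Rightarrow> real"
  assumes f [measurable]: "f \<in> borel_measurable borel"
    and f_nonneg: "\<And>y. 0 \<le> f y"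
    and q: "case_prod q \<in> borel_measurable borel"
    and q_nonneg: "\<And>y' y. 0 \<le> q y' y"
    and q_prob: "\<And>y. prob_space (density lborel (\<lambda>y'. ennreal (q y' y)))"
  shows "mh_kernel f q \<in> borel \<rightarrow>\<^sub>M prob_algebra borel"
proof -
  have q' [measurable]: "case_prod q \<in> borel_measurable (borel \<Otimes>\<^sub>M borel)"
    unfolding borel_prod by fact
  define g where "g y z = q z y * mh_accept f q y z" for y z
  have g [measurable]: "case_prod g \<in> borel_measurable (borel \<Otimes>\<^sub>M borel)"
    unfolding g_def mh_accept_def by measurable
  have g_nonneg: "0 \<le> g y z" for y z
    by (simp add: g_def q_nonneg f_nonneg mh_accept_nonneg)
  have g_le: "g y z \<le> q z y" for y z
    using mult_left_mono[OF mh_accept_le_1 q_nonneg] by (simp add: g_def)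
  have q_int: "(\<integral>\<^sup>+z. ennreal (q z y) \<partial>lborel) = 1" for y
    using prob_space.emeasure_space_1[OF q_prob[of y]] by (simp add: emeasure_density)
  have g_int_le: "(\<integral>\<^sup>+z. ennreal (g y z) \<partial>lborel) \<le> 1" for y
    unfolding q_int[of y, symmetric] by (intro nn_integral_mono ennreal_leI g_le)
  \<comment> \<open>Integrability has to be established: otherwise the Bochner integral in the rejection
    probability could be the default \<open>0\<close> and the two masses would not add up to \<open>1\<close>.\<close>
  have g_int: "(\<integral>\<^sup>+z. ennreal (g y z) \<partial>lborel) = ennreal (LINT z|lborel. g y z)" for y
  proof (rule nn_integral_eq_integral)
    have "(\<integral>\<^sup>+z. ennreal (g y z) \<partial>lborel) < \<infinity>"
      by (rule le_less_trans[OF g_int_le]) simp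
    then show "integrable lborel (g y)"
      by (intro integrableI_nonneg) (auto simp: g_nonneg)
  qed (simp add: g_nonneg)
  have reject: "mh_reject f q y = 1 - (LINT z|lborel. g y z)" for y
    by (simp add: mh_reject_def g_def)
  have reject_nonneg: "0 \<le> mh_reject f q y" for y
    using g_int_le[of y] by (simp add: reject g_int)
  have [measurable]: "mh_reject f q \<in> borel_measurable borel"
    unfolding reject[abs_def] by measurable
  have em: "emeasure (mh_kernel f q y) A
      = (\<integral>\<^sup>+z\<in>A. ennreal (g y z) \<partial>lborel) + ennreal (mh_reject f q y) * indicator A y"
    if "A \<in> sets borel" for y A
    using emeasure_mh_kernel[OF f q that] by (simp add: g_def)
  have space [simp]: "space (mh_kernel f q y) = UNIV" for y
    using sets_eq_imp_space_eq[OF sets_mh_kernel] by simp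
  have "emeasure (mh_kernel f q y) UNIV = 1" for y
  proof -
    have "0 \<le> (LINT z|lborel. g y z)"
      by (rule Bochner_Integration.integral_nonneg) (rule g_nonneg)
    moreover have "(LINT z|lborel. g y z) + mh_reject f q y = 1"
      by (simp add: reject)
    ultimately show ?thesis
      using reject_nonneg[of y] by (simp add: em g_int flip: ennreal_plus)
  qed
  then have prob: "prob_space (mh_kernel f q y)" for y
    by (intro prob_spaceI) simp
  show ?thesis
  proof (intro measurable_prob_algebraI measurable_subprob_algebra)
    fix A :: "'b set"
    assume [measurable]: "A \<in> sets borel"
    show "(\<lambda>y. emeasure (mh_kernel f q y) A) \<in> borel_measurable borel"
      by (simp add: em)
  qed (simp_all add: prob prob_space_imp_subprob_space)
qed

section \<open>Total variation and Markov kernels\<close>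

text \<open>For arbitrary measures the supremum of reals may be over an unbounded set, where it has no
  meaning; for probability measures all differences are at most \<open>1\<close>.\<close>

lemma tv_dist_upper:
  fixes \<mu> \<nu> :: "'s::topological_space measure"
  assumes "prob_space \<mu>" "prob_space \<nu>" "A \<in> sets borel"
  shows "\<bar>measure \<mu> A - measure \<nu> A\<bar> \<le> tv_dist \<mu> \<nu>"
  unfolding tv_dist_def
proof (rule cSUP_upper[OF assms(3)], rule bdd_aboveI2)
  fix B
  show "\<bar>measure \<mu> B - measure \<nu> B\<bar> \<le> 1"
    using prob_space.prob_le_1[OF assms(1), of B] prob_space.prob_le_1[OF assms(2), of B]
      measure_nonneg[of \<mu> B] measure_nonneg[of \<nu> B]
    by linarith
qed

lemma tv_dist_least:
  fixes \<mu> \<nu> :: "'s::topological_space measure"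
  assumes "\<And>A. A \<in> sets borel \<Longrightarrow> \<bar>measure \<mu> A - measure \<nu> A\<bar> \<le> d"
  shows "tv_dist \<mu> \<nu> \<le> d"
  unfolding tv_dist_def by (rule cSUP_least) (auto intro: assms)

text \<open>Write \<open>\<phi> x\<close> as the length of \<open>{s. 0 \<le> s < \<phi> x}\<close> and exchange the two integrals. As
  \<open>\<phi> \<le> 1\<close>, levels \<open>s\<close> in the unit interval suffice, and this bounded range is what keeps an additive
  error in the measures of the level sets from growing on integration.\<close>

lemma nn_integral_layer_cake:
  fixes \<phi> :: "'s \<Rightarrow> ennreal"
  assumes "sigma_finite_measure \<mu>"
    and [measurable]: "\<phi> \<in> borel_measurable \<mu>"
    and le_1: "\<And>x. \<phi> x \<le> 1"
  shows "(\<integral>\<^sup>+x. \<phi> x \<partial>\<mu>)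
    = (\<integral>\<^sup>+s\<in>{0..1}. emeasure \<mu> {x \<in> space \<mu>. ennreal s < \<phi> x} \<partial>lborel)"
proof -
  interpret pair_sigma_finite \<mu> lborel
    using assms(1) lborel.sigma_finite_measure_axioms by (simp add: pair_sigma_finite_def)
  let ?h = "\<lambda>x s. indicator {(x, s). ennreal s < \<phi> x \<and> s \<in> {0..1}} (x, s) :: ennreal"
  have "\<phi> x = (\<integral>\<^sup>+s. ?h x s \<partial>lborel)" for x
  proof -
    obtain r where r: "\<phi> x = ennreal r" "0 \<le> r" "r \<le> 1"
      using le_1[of x] by (cases "\<phi> x") (auto simp: top_unique)
    \<comment> \<open>\<open>ennreal s\<close> is \<open>0\<close> for negative \<open>s\<close>, so the restriction to \<open>{0..1}\<close> also excludes these.\<close>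
    have "?h x s = indicator {0..<r} s" for s
      using r by (auto simp: indicator_def ennreal_less_iff)
    then show ?thesis
      using r by simp
  qed
  then have "(\<integral>\<^sup>+x. \<phi> x \<partial>\<mu>) = (\<integral>\<^sup>+x. \<integral>\<^sup>+s. ?h x s \<partial>lborel \<partial>\<mu>)"
    by (rule nn_integral_cong)
  also have "\<dots> = (\<integral>\<^sup>+s. \<integral>\<^sup>+x. ?h x s \<partial>\<mu> \<partial>lborel)"
    by (rule Fubini'[symmetric]) measurable
  also have "\<dots> = (\<integral>\<^sup>+s\<in>{0..1}. emeasure \<mu> {x \<in> space \<mu>. ennreal s < \<phi> x} \<partial>lborel)"
  proof (rule nn_integral_cong)
    fix s :: real
    have "(\<integral>\<^sup>+x. ?h x s \<partial>\<mu>)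
        = (\<integral>\<^sup>+x. indicator {x \<in> space \<mu>. ennreal s < \<phi> x} x * indicator {0..1} s \<partial>\<mu>)"
      by (rule nn_integral_cong) (auto simp: indicator_def)
    then show "(\<integral>\<^sup>+x. ?h x s \<partial>\<mu>)
        = emeasure \<mu> {x \<in> space \<mu>. ennreal s < \<phi> x} * indicator {0..1} s"
      by (simp add: nn_integral_multc)
  qed
  finally show ?thesis .
qed

text \<open>A uniform error \<open>d\<close> on sets passes to functions with values in \<open>[0, 1]\<close> with the same
  constant: apply the bound to every level set and integrate over levels in an interval of length
  \<open>1\<close>. The one-sided form lets everything take place in the extended nonnegative reals, with no
  integrability conditions.\<close>

lemma nn_integral_le_of_measure_le:
  fixes \<phi> :: "'s \<Rightarrow> ennreal"
  assumes "prob_space \<mu>" "prob_space \<nu>"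
    and sets: "sets \<mu> = sets M" "sets \<nu> = sets M"
    and \<phi> [measurable]: "\<phi> \<in> borel_measurable M"
    and le_1: "\<And>x. \<phi> x \<le> 1"
    and le: "\<And>B. B \<in> sets M \<Longrightarrow> emeasure \<mu> B \<le> emeasure \<nu> B + d"
  shows "(\<integral>\<^sup>+x. \<phi> x \<partial>\<mu>) \<le> (\<integral>\<^sup>+x. \<phi> x \<partial>\<nu>) + d"
proof -
  interpret \<mu>: prob_space \<mu> by fact
  interpret \<nu>: prob_space \<nu> by fact
  have [measurable_cong]: "sets \<mu> = sets M" "sets \<nu> = sets M" by fact+
  have space: "space \<mu> = space M" "space \<nu> = space M"
    using sets by (auto dest: sets_eq_imp_space_eq)
  \<comment> \<open>The measure of the level sets depends measurably on \<open>s\<close>, as they are the sections of one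
    set in the product space.\<close>
  have meas: "(\<lambda>s. emeasure \<nu> {x \<in> space M. ennreal s < \<phi> x}) \<in> borel_measurable borel"
  proof -
    have "{z \<in> space (borel \<Otimes>\<^sub>M \<nu>). ennreal (fst z) < \<phi> (snd z)} \<in> sets (borel \<Otimes>\<^sub>M \<nu>)"
      by measurable
    from \<nu>.measurable_emeasure_Pair[OF this] show ?thesis
      by (simp add: vimage_def space_pair_measure space cong: conj_cong)
  qed
  have "(\<integral>\<^sup>+x. \<phi> x \<partial>\<mu>)
      = (\<integral>\<^sup>+s\<in>{0..1}. emeasure \<mu> {x \<in> space M. ennreal s < \<phi> x} \<partial>lborel)"
    using nn_integral_layer_cake[OF \<mu>.sigma_finite_measure_axioms _ le_1] by (simp add: space)
  also have "\<dots> \<le> (\<integral>\<^sup>+s. emeasure \<nu> {x \<in> space M. ennreal s < \<phi> x} * indicator {0..1} s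
      + d * indicator {0..1} s \<partial>lborel)"
    by (intro nn_integral_mono) (auto simp: indicator_def intro!: le)
  also have "\<dots> = (\<integral>\<^sup>+s\<in>{0..1}. emeasure \<nu> {x \<in> space M. ennreal s < \<phi> x} \<partial>lborel)
      + (\<integral>\<^sup>+s. d * indicator {0..1::real} s \<partial>lborel)"
    using meas by (intro nn_integral_add) auto
  also have "(\<integral>\<^sup>+s. d * indicator {0..1::real} s \<partial>lborel) = d"
    by (simp add: nn_integral_cmult_indicator)
  also have "(\<integral>\<^sup>+s\<in>{0..1}. emeasure \<nu> {x \<in> space M. ennreal s < \<phi> x} \<partial>lborel)
      = (\<integral>\<^sup>+x. \<phi> x \<partial>\<nu>)"
    using nn_integral_layer_cake[OF \<nu>.sigma_finite_measure_axioms _ le_1] by (simp add: space)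
  finally show ?thesis .
qed

lemma prob_space_bind_kernel:
  assumes "prob_space \<mu>" "sets \<mu> = sets M" "K \<in> M \<rightarrow>\<^sub>M prob_algebra N"
  shows "prob_space (\<mu> \<bind> K)" "sets (\<mu> \<bind> K) = sets N"
proof -
  have "\<mu> \<in> space (prob_algebra M)"
    using assms by (simp add: space_prob_algebra)
  then have "\<mu> \<bind> K \<in> space (prob_algebra N)"
    using assms(3) measurable_space[OF measurable_bind_prob_space[OF measurable_const assms(3)]]
    by fastforce
  then show "prob_space (\<mu> \<bind> K)" "sets (\<mu> \<bind> K) = sets N"
    by (simp_all add: space_prob_algebra)
qed

text \<open>Total variation contracts under Markov kernels: \<open>(\<mu> \<bind> K) A\<close> is the \<open>\<mu>\<close>-integral of the
  \<open>[0, 1]\<close>-valued function \<open>y \<mapsto> K y A\<close>, to which the uniform bound on sets extends. Exchanging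
  \<open>\<mu>\<close> and \<open>\<nu>\<close> gives the bound on the absolute value.\<close>

lemma tv_dist_bind_le:
  fixes K :: "'s::topological_space \<Rightarrow> 't::topological_space measure"
  assumes \<mu>: "prob_space \<mu>" "sets \<mu> = sets borel"
    and \<nu>: "prob_space \<nu>" "sets \<nu> = sets borel"
    and K: "K \<in> borel \<rightarrow>\<^sub>M prob_algebra borel"
  shows "tv_dist (\<mu> \<bind> K) (\<nu> \<bind> K) \<le> tv_dist \<mu> \<nu>"
proof (rule tv_dist_least)
  fix A :: "'t set"
  assume A [measurable]: "A \<in> sets borel"
  note K' [measurable] = measurable_prob_algebraD[OF K]
  have d_nonneg: "0 \<le> tv_dist \<mu> \<nu>"
    using tv_dist_upper[OF \<mu>(1) \<nu>(1), of "{}"] by simp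
  have K_prob: "prob_space (K y)" for y
    using measurable_space[OF K, of y] by (simp add: space_prob_algebra)
  have one_sided: "measure (\<mu>' \<bind> K) A \<le> measure (\<nu>' \<bind> K) A + tv_dist \<mu> \<nu>"
    if \<mu>': "prob_space \<mu>'" "sets \<mu>' = sets borel" and \<nu>': "prob_space \<nu>'" "sets \<nu>' = sets borel"
      and le: "\<And>B. B \<in> sets borel \<Longrightarrow> measure \<mu>' B \<le> measure \<nu>' B + tv_dist \<mu> \<nu>"
    for \<mu>' \<nu>'
  proof -
    interpret \<mu>': prob_space \<mu>' by fact
    interpret \<nu>': prob_space \<nu>' by fact
    interpret \<mu>K: prob_space "\<mu>' \<bind> K" by (rule prob_space_bind_kernel[OF \<mu>' K])
    interpret \<nu>K: prob_space "\<nu>' \<bind> K" by (rule prob_space_bind_kernel[OF \<nu>' K])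
    have em: "emeasure (\<rho> \<bind> K) A = (\<integral>\<^sup>+y. emeasure (K y) A \<partial>\<rho>)"
      if "sets \<rho> = sets borel" for \<rho>
      using K' sets_eq_imp_space_eq[OF that]
      by (intro emeasure_bind[OF _ _ A]) (simp_all add: measurable_cong_sets[OF that refl])
    have "(\<integral>\<^sup>+y. emeasure (K y) A \<partial>\<mu>')
        \<le> (\<integral>\<^sup>+y. emeasure (K y) A \<partial>\<nu>') + ennreal (tv_dist \<mu> \<nu>)"
    proof (rule nn_integral_le_of_measure_le[OF \<mu>'(1) \<nu>'(1) \<mu>'(2) \<nu>'(2)])
      show "emeasure (K y) A \<le> 1" for y
        using prob_space.emeasure_le_1[OF K_prob] .
      show "emeasure \<mu>' B \<le> emeasure \<nu>' B + ennreal (tv_dist \<mu> \<nu>)" if "B \<in> sets borel" for B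
        using le[OF that] d_nonneg
        by (simp add: \<mu>'.emeasure_eq_measure \<nu>'.emeasure_eq_measure flip: ennreal_plus)
    qed measurable
    then show ?thesis
      using d_nonneg
      by (simp add: em[OF \<mu>'(2), symmetric] em[OF \<nu>'(2), symmetric]
          \<mu>K.emeasure_eq_measure \<nu>K.emeasure_eq_measure flip: ennreal_plus)
  qed
  have close: "measure \<mu> B \<le> measure \<nu> B + tv_dist \<mu> \<nu>"
    "measure \<nu> B \<le> measure \<mu> B + tv_dist \<mu> \<nu>" if "B \<in> sets borel" for B
    using tv_dist_upper[OF \<mu>(1) \<nu>(1) that] by linarith+
  show "\<bar>measure (\<mu> \<bind> K) A - measure (\<nu> \<bind> K) A\<bar> \<le> tv_dist \<mu> \<nu>"
    using one_sided[OF \<mu> \<nu> close(1)] one_sided[OF \<nu> \<mu> close(2)] by linarith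
qed

section \<open>Lifting marginal laws to the joint space\<close>

lemma pairing_kernel_measurable:
  fixes c :: "'b::euclidean_space \<Rightarrow> 'a::euclidean_space measure"
  assumes "c \<in> borel \<rightarrow>\<^sub>M prob_algebra borel"
  shows "(\<lambda>y. distr (c y) borel (\<lambda>x. (x, y))) \<in> borel \<rightarrow>\<^sub>M prob_algebra borel"
proof (rule measurable_prob_algebraI)
  fix y :: 'b
  have "prob_space (c y)" "sets (c y) = sets borel"
    using measurable_space[OF assms, of y] by (simp_all add: space_prob_algebra)
  then show "prob_space (distr (c y) borel (\<lambda>x. (x, y)))"
    by (intro prob_space.prob_space_distr)
      (simp_all add: measurable_cong_sets[OF \<open>sets (c y) = sets borel\<close> refl])
next
  show "(\<lambda>y. distr (c y) borel (\<lambda>x. (x, y))) \<in> borel \<rightarrow>\<^sub>M subprob_algebra borel"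
    by (rule measurable_distr2[OF _ measurable_prob_algebraD[OF assms]]) measurable
qed

lemma prob_space_kernel_joint:
  fixes c :: "'b::euclidean_space \<Rightarrow> 'a::euclidean_space measure"
  assumes "c \<in> borel \<rightarrow>\<^sub>M prob_algebra borel" "prob_space \<nu>" "sets \<nu> = sets borel"
  shows "prob_space (kernel_joint c \<nu>)"
  unfolding kernel_joint_def
  by (rule prob_space_bind_kernel[OF assms(2,3) pairing_kernel_measurable[OF assms(1)]])

text \<open>Every \<open>c y\<close> has total mass \<open>1\<close>, so drawing \<open>x\<close> does not change the law of \<open>y\<close>. For
  \<open>B = UNIV\<close> this says that \<open>\<nu>\<close> and its lift have the same total mass.\<close>

lemma emeasure_kernel_joint_cylinder:
  fixes c :: "'b::euclidean_space \<Rightarrow> 'a::euclidean_space measure"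
  assumes c: "c \<in> borel \<rightarrow>\<^sub>M prob_algebra borel" and \<nu>: "sets \<nu> = sets borel"
    and B [measurable]: "B \<in> sets borel"
  shows "emeasure (kernel_joint c \<nu>) (UNIV \<times> B) = emeasure \<nu> B"
proof -
  let ?K = "\<lambda>y. distr (c y) borel (\<lambda>x. (x, y))"
  note K = measurable_prob_algebraD[OF pairing_kernel_measurable[OF c]]
  have UB: "UNIV \<times> B \<in> sets (borel :: ('a \<times> 'b) measure)"
    by (simp flip: borel_prod)
  have "emeasure (kernel_joint c \<nu>) (UNIV \<times> B) = (\<integral>\<^sup>+y. emeasure (?K y) (UNIV \<times> B) \<partial>\<nu>)"
    unfolding kernel_joint_def
    using K sets_eq_imp_space_eq[OF \<nu>]
    by (intro emeasure_bind[OF _ _ UB]) (simp_all add: measurable_cong_sets[OF \<nu> refl])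
  also have "\<dots> = (\<integral>\<^sup>+y. indicator B y \<partial>\<nu>)"
  proof (rule nn_integral_cong)
    fix y
    have c_y: "prob_space (c y)" "sets (c y) = sets borel"
      using measurable_space[OF c, of y] by (simp_all add: space_prob_algebra)
    have "emeasure (?K y) (UNIV \<times> B) = emeasure (c y) ((\<lambda>x. (x, y)) -` (UNIV \<times> B) \<inter> space (c y))"
      by (rule emeasure_distr[OF _ UB]) (simp add: measurable_cong_sets[OF c_y(2) refl])
    also have "(\<lambda>x. (x, y)) -` (UNIV \<times> B) \<inter> space (c y) = (if y \<in> B then space (c y) else {})"
      by auto
    finally show "emeasure (?K y) (UNIV \<times> B) = indicator B y"
      using prob_space.emeasure_space_1[OF c_y(1)] by simp
  qed
  also have "\<dots> = emeasure \<nu> B"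
    using \<nu> by simp
  finally show ?thesis .
qed

text \<open>Lifting is the action of a Markov kernel, which contracts, and cylinders over Borel sets of
  \<open>y\<close>-values already realise every difference between \<open>\<mu>\<close> and \<open>\<nu>\<close>.\<close>

lemma tv_dist_kernel_joint:
  fixes c :: "'b::euclidean_space \<Rightarrow> 'a::euclidean_space measure"
  assumes c: "c \<in> borel \<rightarrow>\<^sub>M prob_algebra borel"
    and \<mu>: "prob_space \<mu>" "sets \<mu> = sets borel"
    and \<nu>: "prob_space \<nu>" "sets \<nu> = sets borel"
  shows "tv_dist (kernel_joint c \<mu>) (kernel_joint c \<nu>) = tv_dist \<mu> \<nu>"
proof (rule antisym)
  show "tv_dist (kernel_joint c \<mu>) (kernel_joint c \<nu>) \<le> tv_dist \<mu> \<nu>"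
    unfolding kernel_joint_def by (rule tv_dist_bind_le[OF \<mu> \<nu> pairing_kernel_measurable[OF c]])
  show "tv_dist \<mu> \<nu> \<le> tv_dist (kernel_joint c \<mu>) (kernel_joint c \<nu>)"
  proof (rule tv_dist_least)
    fix B :: "'b set"
    assume B [measurable]: "B \<in> sets borel"
    have "UNIV \<times> B \<in> sets (borel :: ('a \<times> 'b) measure)"
      by (simp flip: borel_prod)
    then have "\<bar>measure (kernel_joint c \<mu>) (UNIV \<times> B) - measure (kernel_joint c \<nu>) (UNIV \<times> B)\<bar>
        \<le> tv_dist (kernel_joint c \<mu>) (kernel_joint c \<nu>)"
      by (rule tv_dist_upper[OF prob_space_kernel_joint[OF c \<mu>] prob_space_kernel_joint[OF c \<nu>]])
    then show "\<bar>measure \<mu> B - measure \<nu> B\<bar> \<le> tv_dist (kernel_joint c \<mu>) (kernel_joint c \<nu>)"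
      by (simp add: measure_def emeasure_kernel_joint_cylinder[OF c _ B] \<mu> \<nu>)
  qed
qed

section \<open>The MarCo chain is the lifted marginal chain\<close>

text \<open>Lifting intertwines the two kernels: by associativity both sides are \<open>\<mu> \<bind> k \<bind> K\<close>, where
  \<open>K\<close> attaches a draw from \<open>c y\<close> to \<open>y\<close>, once it is seen that an attached \<open>x\<close> does not influence the
  next MarCo step.\<close>

lemma kernel_joint_bind_marco_kernel:
  fixes c :: "'b::euclidean_space \<Rightarrow> 'a::euclidean_space measure"
  assumes c: "c \<in> borel \<rightarrow>\<^sub>M prob_algebra borel"
    and k: "k \<in> borel \<rightarrow>\<^sub>M prob_algebra borel"
    and \<mu>: "sets \<mu> = sets borel"
  shows "kernel_joint c \<mu> \<bind> marco_kernel c k = kernel_joint c (\<mu> \<bind> k)"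
proof -
  define K where "K y = distr (c y) borel (\<lambda>x. (x, y))" for y
  have joint: "kernel_joint c \<nu> = \<nu> \<bind> K" for \<nu>
    by (simp add: kernel_joint_def K_def[abs_def])
  have K [measurable]: "K \<in> borel \<rightarrow>\<^sub>M subprob_algebra borel"
    unfolding K_def[abs_def] by (rule measurable_prob_algebraD[OF pairing_kernel_measurable[OF c]])
  have k' [measurable]: "k \<in> borel \<rightarrow>\<^sub>M subprob_algebra borel"
    by (rule measurable_prob_algebraD[OF k])
  have kK [measurable]: "(\<lambda>y. k y \<bind> K) \<in> borel \<rightarrow>\<^sub>M subprob_algebra borel"
    by (rule measurable_bind2[OF k' K])
  have marco: "marco_kernel c k = (\<lambda>z. k (snd z) \<bind> K)"
    by (auto simp: marco_kernel_def joint)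
  have snd: "snd \<in> (borel :: ('a \<times> 'b) measure) \<rightarrow>\<^sub>M borel"
    by (simp flip: borel_prod)
  have marco_meas: "marco_kernel c k \<in> borel \<rightarrow>\<^sub>M subprob_algebra borel"
    unfolding marco by (rule measurable_compose[OF snd kK])
  have forget: "K y \<bind> marco_kernel c k = k y \<bind> K" for y
  proof -
    have c_y: "prob_space (c y)" "sets (c y) = sets borel"
      using measurable_space[OF c, of y] by (simp_all add: space_prob_algebra)
    have "K y \<bind> marco_kernel c k = c y \<bind> (\<lambda>x. marco_kernel c k (x, y))"
      unfolding K_def
      by (rule bind_distr[OF _ marco_meas prob_space.not_empty[OF c_y(1)]])
        (simp add: measurable_cong_sets[OF c_y(2) refl])
    also have "\<dots> = c y \<bind> (\<lambda>x. k y \<bind> K)"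
      by (simp add: marco)
    also have "\<dots> = k y \<bind> K"
      using measurable_space[OF kK, of y]
      by (intro bind_const'[OF c_y(1)]) (simp add: space_subprob_algebra)
    finally show ?thesis .
  qed
  have K_\<mu>: "K \<in> \<mu> \<rightarrow>\<^sub>M subprob_algebra borel" and k_\<mu>: "k \<in> \<mu> \<rightarrow>\<^sub>M subprob_algebra borel"
    using K k' by (simp_all add: measurable_cong_sets[OF \<mu> refl])
  have "kernel_joint c \<mu> \<bind> marco_kernel c k = \<mu> \<bind> (\<lambda>y. K y \<bind> marco_kernel c k)"
    unfolding joint by (rule bind_assoc[OF K_\<mu> marco_meas])
  also have "\<dots> = \<mu> \<bind> k \<bind> K"
    unfolding forget by (rule bind_assoc[OF k_\<mu> K, symmetric])
  finally show ?thesis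
    by (simp add: joint)
qed

lemma chain_law_prob_space:
  assumes "k \<in> borel \<rightarrow>\<^sub>M prob_algebra borel" "prob_space \<mu>" "sets \<mu> = sets borel"
  shows "prob_space (chain_law k \<mu> t) \<and> sets (chain_law k \<mu> t) = sets borel"
  using assms by (induction t) (simp_all add: prob_space_bind_kernel)

lemma chain_law_marco_kernel:
  fixes c :: "'b::euclidean_space \<Rightarrow> 'a::euclidean_space measure"
  assumes c: "c \<in> borel \<rightarrow>\<^sub>M prob_algebra borel"
    and k: "k \<in> borel \<rightarrow>\<^sub>M prob_algebra borel"
    and \<mu>: "prob_space \<mu>" "sets \<mu> = sets borel"
  shows "chain_law (marco_kernel c k) (kernel_joint c \<mu>) t = kernel_joint c (chain_law k \<mu> t)"
  by (induction t) (simp_all add: kernel_joint_bind_marco_kernel c k chain_law_prob_space \<mu>)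

theorem theorem3p3:
  fixes p :: "(real ^ 'nx) \<times> (real ^ 'ny) \<Rightarrow> real"
    and c :: "real ^ 'ny \<Rightarrow> (real ^ 'nx) measure"
    and q :: "real ^ 'ny \<Rightarrow> real ^ 'ny \<Rightarrow> real"
    and \<mu>0 \<pi>marg :: "(real ^ 'ny) measure"
    and \<pi>joint \<pi>M0 :: "((real ^ 'nx) \<times> (real ^ 'ny)) measure"
    and kmarg :: "real ^ 'ny \<Rightarrow> (real ^ 'ny) measure"
    and kM :: "(real ^ 'nx) \<times> (real ^ 'ny) \<Rightarrow> ((real ^ 'nx) \<times> (real ^ 'ny)) measure"
  defines "\<pi>joint \<equiv> density lborel (\<lambda>z. ennreal (p z))"
    and "\<pi>marg \<equiv> density lborel (\<lambda>y. ennreal (marg_density p y))"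
    and "kmarg \<equiv> mh_kernel (marg_density p) q"
    and "kM \<equiv> marco_kernel c kmarg"
    and "\<pi>M0 \<equiv> kernel_joint c \<mu>0"
  assumes p_meas: "p \<in> borel_measurable borel"
    and p_nonneg: "\<And>z. 0 \<le> p z"
    and p_prob: "prob_space \<pi>joint"
    and cond_kernel: "c \<in> borel \<rightarrow>\<^sub>M prob_algebra borel"
    and disintegration: "\<pi>joint = kernel_joint c \<pi>marg"
    and q_meas: "(\<lambda>(y', y). q y' y) \<in> borel_measurable borel"
    and q_nonneg: "\<And>y' y. 0 \<le> q y' y"
    and q_prob: "\<And>y. prob_space (density lborel (\<lambda>y'. ennreal (q y' y)))"
    and init_prob: "prob_space \<mu>0" "sets \<mu>0 = sets borel"
  shows "(((\<lambda>t. tv_dist (chain_law kmarg \<mu>0 t) \<pi>marg) \<longlonglongrightarrow> 0)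
            \<longrightarrow> ((\<lambda>t. tv_dist (chain_law kM \<pi>M0 t) \<pi>joint) \<longlonglongrightarrow> 0))
         \<and> (\<forall>\<epsilon>>0. mixing_time kM \<pi>joint \<epsilon> \<pi>M0 = mixing_time kmarg \<pi>marg \<epsilon> \<mu>0)"
proof -
  have kmarg: "kmarg \<in> borel \<rightarrow>\<^sub>M prob_algebra borel"
    unfolding kmarg_def
    using borel_measurable_marg_density[OF p_meas] marg_density_nonneg[of p] p_nonneg
      q_meas q_nonneg q_prob
    by (intro mh_kernel_measurable) auto
  have sets_marg: "sets \<pi>marg = sets borel"
    by (simp add: \<pi>marg_def)
  \<comment> \<open>The disintegration transfers total mass \<open>1\<close> from the joint to the marginal target.\<close>
  have "emeasure \<pi>marg UNIV = emeasure \<pi>joint UNIV"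
    using emeasure_kernel_joint_cylinder[OF cond_kernel sets_marg, of UNIV]
    by (simp add: disintegration)
  also have "\<dots> = 1"
    using prob_space.emeasure_space_1[OF p_prob] by (simp add: \<pi>joint_def)
  finally have prob_marg: "prob_space \<pi>marg"
    by (intro prob_spaceI) (simp add: \<pi>marg_def)
  have tv: "tv_dist (chain_law kM \<pi>M0 t) \<pi>joint = tv_dist (chain_law kmarg \<mu>0 t) \<pi>marg" for t
    unfolding disintegration kM_def \<pi>M0_def chain_law_marco_kernel[OF cond_kernel kmarg init_prob]
    using chain_law_prob_space[OF kmarg init_prob]
    by (intro tv_dist_kernel_joint cond_kernel prob_marg sets_marg) auto
  then show ?thesis
    by (simp add: mixing_time_def)
qed

end
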